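(* Let $\Omega\subset\mathbb{R}^n$ be a nonempty closed convex set, let $f(x)=\sum_{j=1}^m w_j\|x-a^j\|$ be the Weber function, and let $Q:\Omega\to\Omega$ be the iteration function defined in the context. Let $x\in\Omega$ be such that $x\neq Q(x)$. Then $f(Q(x))<f(x)$.
   Context: Throughout, $\|\cdot\|$ and $\langle\cdot,\cdot\rangle$ are the Euclidean norm and inner product on $\mathbb{R}^n$. $a^1,\dots,a^m\in\mathbb{R}^n$ are distinct, non-collinear points (the vertices), $w_1,\dots,w_m>0$ are weights, and $f(x)=\sum_{j=1}^m w_j\|x-a^j\|$. $\Omega\subset\mathbb{R}^n$ is nonempty, closed and convex, with orthogonal projection $P_\Omega:\mathbb{R}^n\to\Omega$. Define, for $x\in\mathbb{R}^n$: - $A(x)=\sum_{j=1}^m\frac{w_j}{2\|x-a^j\|}$ if $x\neq a^1,\dots,a^m$, and $A(a^k)=\sum_{j\neq k}\frac{w_j}{2\|a^k-a^j\|}$. - $\widetilde T(x)=\frac{1}{2A(x)}\sum_{j=1}^m\frac{w_ja^j}{\|x-a^j\|}$ if $x\neq a^1,\dots,a^m$, and $\widetilde T(a^k)=\frac{1}{2A(a^k)}\sum_{j\neq k}\frac{w_ja^j}{\|a^k-a^j\|}$. - $\widetilde R(x)=\sum_{j=1}^m\frac{w_j(a^j-x)}{\|x-a^j\|}$ if $x\neq a^1,\dots,a^m$, and $\widetilde R(a^k)=\sum_{j\neq k}\frac{w_j(a^j-a^k)}{\|a^k-a^j\|}$; $r(x)=\|\widetilde R(x)\|$. - $\gamma(x)=0$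 if $x\neq a^1,\dots,a^m$; $\gamma(a^k)=0$ if $r(a^k)=0$; $\gamma(a^k)=w_k/r(a^k)$ if $r(a^k)\neq 0$. $\beta(x)=\min\{1,\gamma(x)\}$. - $T(x)=(1-\beta(x))\widetilde T(x)+\beta(x)x$. For $a^k\in\Omega$ let $\lambda(a^k)=\inf\{\lambda\in[0,1]:(1-\lambda)T(a^k)+\lambda a^k\in\Omega\}$. The iteration function $Q:\Omega\to\Omega$ is $Q(x)=P_\Omega(T(x))$ if $x\neq a^1,\dots,a^m$, and $Q(a^k)=(1-\lambda(a^k))T(a^k)+\lambda(a^k)a^k$ if $x=a^k\in\Omega$. *)

theory Defs
  imports "HOL-Analysis.Analysis"
begin

text \<open>
  The vertices are \<open>a 1, \<dots>, a m\<close> with weights \<open>w 1, \<dots>, w m\<close>; the values of \<open>a\<close> and \<open>w\<close>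
  outside \<open>{1..m}\<close> are never used.
\<close>

definition vertices :: "nat \<Rightarrow> (nat \<Rightarrow> real ^ 'n) \<Rightarrow> (real ^ 'n) set" where
  "vertices m a = a ` {1..m}"

definition weber :: "nat \<Rightarrow> (nat \<Rightarrow> real) \<Rightarrow> (nat \<Rightarrow> real ^ 'n) \<Rightarrow> real ^ 'n \<Rightarrow> real" where
  "weber m w a x = (\<Sum>j=1..m. w j * norm (x - a j))"

text \<open>
  The index set of the sums defining \<open>A\<close>, \<open>T~\<close> and \<open>R~\<close>. It is all of \<open>{1..m}\<close> if \<open>x\<close> is not
  a vertex, and \<open>{1..m} - {k}\<close> if \<open>x = a k\<close>, the vertices being distinct; so each of
  the two-case definitions becomes a single formula.
\<close>

definition other_indices :: "nat \<Rightarrow> (nat \<Rightarrow> real ^ 'n) \<Rightarrow> real ^ 'n \<Rightarrow> nat set" where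
  "other_indices m a x = {j \<in> {1..m}. a j \<noteq> x}"

lemma other_indices_nonvertex:
  "x \<notin> vertices m a \<Longrightarrow> other_indices m a x = {1..m}"
  by (auto simp: other_indices_def vertices_def)

lemma other_indices_vertex:
  "inj_on a {1..m} \<Longrightarrow> k \<in> {1..m} \<Longrightarrow> other_indices m a (a k) = {1..m} - {k}"
  unfolding other_indices_def by (auto dest: inj_onD)

definition weber_A :: "nat \<Rightarrow> (nat \<Rightarrow> real) \<Rightarrow> (nat \<Rightarrow> real ^ 'n) \<Rightarrow> real ^ 'n \<Rightarrow> real" where
  "weber_A m w a x = (\<Sum>j\<in>other_indices m a x. w j / (2 * norm (x - a j)))"

definition T_tilde ::
    "nat \<Rightarrow> (nat \<Rightarrow> real) \<Rightarrow> (nat \<Rightarrow> real ^ 'n) \<Rightarrow> real ^ 'n \<Rightarrow> real ^ 'n" where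
  "T_tilde m w a x =
     (1 / (2 * weber_A m w a x)) *\<^sub>R
       (\<Sum>j\<in>other_indices m a x. (w j / norm (x - a j)) *\<^sub>R a j)"

definition R_tilde ::
    "nat \<Rightarrow> (nat \<Rightarrow> real) \<Rightarrow> (nat \<Rightarrow> real ^ 'n) \<Rightarrow> real ^ 'n \<Rightarrow> real ^ 'n" where
  "R_tilde m w a x =
     (\<Sum>j\<in>other_indices m a x. (w j / norm (x - a j)) *\<^sub>R (a j - x))"

definition weber_r :: "nat \<Rightarrow> (nat \<Rightarrow> real) \<Rightarrow> (nat \<Rightarrow> real ^ 'n) \<Rightarrow> real ^ 'n \<Rightarrow> real" where
  "weber_r m w a x = norm (R_tilde m w a x)"

text \<open>For \<open>x = a k\<close>, distinctness of the vertices gives \<open>inv_into {1..m} a x = k\<close>.\<close>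

definition weber_gamma :: "nat \<Rightarrow> (nat \<Rightarrow> real) \<Rightarrow> (nat \<Rightarrow> real ^ 'n) \<Rightarrow> real ^ 'n \<Rightarrow> real" where
  "weber_gamma m w a x =
     (if x \<notin> vertices m a then 0
      else if weber_r m w a x = 0 then 0
      else w (inv_into {1..m} a x) / weber_r m w a x)"

definition weber_beta :: "nat \<Rightarrow> (nat \<Rightarrow> real) \<Rightarrow> (nat \<Rightarrow> real ^ 'n) \<Rightarrow> real ^ 'n \<Rightarrow> real" where
  "weber_beta m w a x = min 1 (weber_gamma m w a x)"

definition weber_T ::
    "nat \<Rightarrow> (nat \<Rightarrow> real) \<Rightarrow> (nat \<Rightarrow> real ^ 'n) \<Rightarrow> real ^ 'n \<Rightarrow> real ^ 'n" where
  "weber_T m w a x =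
     (1 - weber_beta m w a x) *\<^sub>R T_tilde m w a x + weber_beta m w a x *\<^sub>R x"

text \<open>
  Only meaningful at a vertex \<open>x \<in> \<Omega>\<close>, where the set contains \<open>1\<close> and is bounded below by \<open>0\<close>.
\<close>

definition weber_lambda ::
    "nat \<Rightarrow> (nat \<Rightarrow> real) \<Rightarrow> (nat \<Rightarrow> real ^ 'n) \<Rightarrow> (real ^ 'n) set \<Rightarrow> real ^ 'n \<Rightarrow> real" where
  "weber_lambda m w a \<Omega> x =
     Inf {l \<in> {0..1}. (1 - l) *\<^sub>R weber_T m w a x + l *\<^sub>R x \<in> \<Omega>}"

text \<open>\<open>closest_point \<Omega>\<close> is the orthogonal projection onto the nonempty closed convex set \<open>\<Omega>\<close>.\<close>

definition weber_Q ::
    "nat \<Rightarrow> (nat \<Rightarrow> real) \<Rightarrow> (nat \<Rightarrow> real ^ 'n) \<Rightarrow> (real ^ 'n) set \<Rightarrow> real ^ 'n \<Rightarrow> real ^ 'n" where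
  "weber_Q m w a \<Omega> x =
     (if x \<notin> vertices m a then closest_point \<Omega> (weber_T m w a x)
      else (1 - weber_lambda m w a \<Omega> x) *\<^sub>R weber_T m w a x + weber_lambda m w a \<Omega> x *\<^sub>R x)"

end

theory Submission
  imports Defs
begin

text \<open>
  If \<open>x \<noteq> a\<^sub>j\<close>, then \<open>\<parallel>y - a\<^sub>j\<parallel>\<close> lies below a quadratic function of \<open>y\<close> that touches it at \<open>y = x\<close>:
  by the arithmetic-geometric mean inequality,
  \<open>\<parallel>y - a\<^sub>j\<parallel> \<le> (\<parallel>y - a\<^sub>j\<parallel>\<^sup>2 + \<parallel>x - a\<^sub>j\<parallel>\<^sup>2) / (2 \<parallel>x - a\<^sub>j\<parallel>)\<close>.
  Only the term of a vertex equal to \<open>x\<close> has to be kept as it is. Summing gives the bound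
  \<open>f y - f x \<le> A \<parallel>y - x\<parallel>\<^sup>2 - \<langle>y - x, R\<rangle> + c \<parallel>y - x\<parallel>\<close>
  of \<open>weber_diff_le\<close>, in which \<open>A\<close> and \<open>R\<close> are \<open>weber_A\<close> and \<open>R_tilde\<close> at \<open>x\<close>, and
  \<open>c\<close> is the weight sitting at \<open>x\<close>, zero if \<open>x\<close> is not a vertex. The quadratic part is
  minimal at \<open>x + R / (2 A)\<close>, which is exactly \<open>T_tilde\<close> (\<open>T_tilde_eq\<close>).

  If \<open>x\<close> is not a vertex, the obtuse angle property of the projection \<open>y\<close> of \<open>x + R / (2 A)\<close>
  says \<open>\<langle>y - x, R\<rangle> \<ge> 2 A \<parallel>y - x\<parallel>\<^sup>2\<close>, and the bound is at most \<open>- A \<parallel>y - x\<parallel>\<^sup>2\<close>.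

  If \<open>x\<close> is a vertex, the new point is \<open>x + s R\<close> with \<open>0 \<le> 2 A s \<le> 1 - \<beta>\<close>. When it moves,
  \<open>s > 0\<close>, \<open>R \<noteq> 0\<close> and \<open>\<beta> = c / \<parallel>R\<parallel> < 1\<close>. The bound becomes
  \<open>s \<parallel>R\<parallel>\<^sup>2 (A s - (1 - \<beta>)) \<le> - s \<parallel>R\<parallel>\<^sup>2 (1 - \<beta>) / 2\<close>: the damping by \<open>\<beta>\<close> pays exactly for the kink
  of \<open>f\<close> at \<open>x\<close>, and any step towards \<open>T\<close> decreases \<open>f\<close>, whatever fraction \<open>\<Omega>\<close> allows.
\<close>

text \<open>Without other vertices all vertices would coincide with \<open>x\<close> and hence be collinear.\<close>

lemma weber_A_pos:
  fixes a :: "nat \<Rightarrow> real ^ 'n"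
  assumes "\<not> collinear (vertices m a)"
    and "\<And>j. j \<in> {1..m} \<Longrightarrow> w j > 0"
  shows "weber_A m w a x > 0"
proof -
  have "other_indices m a x \<noteq> {}"
  proof
    assume "other_indices m a x = {}"
    then have "vertices m a \<subseteq> {x}"
      by (auto simp: other_indices_def vertices_def)
    then show False
      using assms(1) collinear_subset collinear_sing by blast
  qed
  moreover have "finite (other_indices m a x)"
    by (simp add: other_indices_def)
  ultimately show ?thesis
    unfolding weber_A_def using assms(2)
    by (intro sum_pos) (auto simp: other_indices_def)
qed

lemma T_tilde_eq:
  fixes a :: "nat \<Rightarrow> real ^ 'n"
  assumes "weber_A m w a x \<noteq> 0"
  shows "T_tilde m w a x = x + (1 / (2 * weber_A m w a x)) *\<^sub>R R_tilde m w a x"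
proof -
  let ?J = "other_indices m a x"
  have "2 * weber_A m w a x = (\<Sum>j\<in>?J. w j / norm (x - a j))"
    by (simp add: weber_A_def sum_distrib_left)
  then have "R_tilde m w a x =
      (\<Sum>j\<in>?J. (w j / norm (x - a j)) *\<^sub>R a j) - (2 * weber_A m w a x) *\<^sub>R x"
    by (simp add: R_tilde_def scaleR_diff_right sum_subtractf scaleR_left.sum)
  then show ?thesis
    using assms by (simp add: T_tilde_def scaleR_diff_right)
qed

text \<open>
  The tangent quadratic majorant of the norm of \<open>y - b\<close> at \<open>y = x\<close>, with its increment
  already expanded around \<open>x\<close>.
\<close>

lemma norm_diff_le_quadratic:
  fixes b x y :: "'a :: real_inner"
  assumes "b \<noteq> x"
  shows "norm (y - b) - norm (x - b) \<le>
    (1 / (2 * norm (x - b))) * (norm (y - x))\<^sup>2 - (1 / norm (x - b)) * inner (y - x) (b - x)"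
proof -
  let ?d = "norm (x - b)"
  have d: "?d > 0" using assms by simp
  have "(norm (y - b))\<^sup>2 = (norm (y - x))\<^sup>2 - 2 * inner (y - x) (b - x) + ?d\<^sup>2"
    unfolding power2_norm_eq_inner by (simp add: inner_diff inner_commute)
  \<comment> \<open>The arithmetic-geometric mean inequality, with equality at \<open>y = x\<close>.\<close>
  moreover have "2 * ?d * norm (y - b) \<le> (norm (y - b))\<^sup>2 + ?d\<^sup>2"
    using sum_squares_bound[of ?d "norm (y - b)"] by simp
  ultimately have "2 * ?d * (norm (y - b) - ?d) \<le> (norm (y - x))\<^sup>2 - 2 * inner (y - x) (b - x)"
    by (simp add: algebra_simps power2_eq_square)
  then have "norm (y - b) - ?d \<le> ((norm (y - x))\<^sup>2 - 2 * inner (y - x) (b - x)) / (2 * ?d)"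
    using d by (simp add: pos_le_divide_eq mult.commute)
  also have "\<dots> = (1 / (2 * ?d)) * (norm (y - x))\<^sup>2 - (1 / ?d) * inner (y - x) (b - x)"
    by (simp add: diff_divide_distrib)
  finally show ?thesis .
qed

text \<open>
  The last sum collects the indices of vertices at \<open>x\<close>, whose terms have no quadratic
  majorant touching at \<open>x\<close> and change by exactly \<open>w\<^sub>j \<parallel>y - x\<parallel>\<close>.
\<close>

lemma weber_diff_le:
  fixes a :: "nat \<Rightarrow> real ^ 'n"
  assumes "\<And>j. j \<in> {1..m} \<Longrightarrow> w j \<ge> 0"
  shows "weber m w a y - weber m w a x \<le>
    weber_A m w a x * (norm (y - x))\<^sup>2 - inner (y - x) (R_tilde m w a x)
      + (\<Sum>j | j \<in> {1..m} \<and> a j = x. w j) * norm (y - x)"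
proof -
  let ?J = "other_indices m a x" and ?K = "{j \<in> {1..m}. a j = x}"
  let ?g = "\<lambda>j. w j * (norm (y - a j) - norm (x - a j))"
  have "weber m w a y - weber m w a x = (\<Sum>j=1..m. ?g j)"
    by (simp add: weber_def right_diff_distrib sum_subtractf)
  also have "{1..m} = ?J \<union> ?K"
    by (auto simp: other_indices_def)
  also have "sum ?g (?J \<union> ?K) = sum ?g ?J + sum ?g ?K"
    by (rule sum.union_disjoint) (auto simp: other_indices_def)
  also have "sum ?g ?K = (\<Sum>j\<in>?K. w j) * norm (y - x)"
    by (simp add: sum_distrib_right)
  also have "sum ?g ?J \<le> (\<Sum>j\<in>?J. w j * ((1 / (2 * norm (x - a j))) * (norm (y - x))\<^sup>2
      - (1 / norm (x - a j)) * inner (y - x) (a j - x)))"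
    using assms
    by (intro sum_mono mult_left_mono norm_diff_le_quadratic) (auto simp: other_indices_def)
  also have "\<dots> = weber_A m w a x * (norm (y - x))\<^sup>2 - inner (y - x) (R_tilde m w a x)"
    by (simp add: weber_A_def R_tilde_def right_diff_distrib sum_subtractf
        sum_distrib_right inner_sum_right)
  finally show ?thesis by simp
qed

lemma weber_lambda_bounds:
  assumes "x \<in> \<Omega>"
  shows "0 \<le> weber_lambda m w a \<Omega> x" "weber_lambda m w a \<Omega> x \<le> 1"
proof -
  let ?S = "{l \<in> {0..1}. (1 - l) *\<^sub>R weber_T m w a x + l *\<^sub>R x \<in> \<Omega>}"
  have 1: "1 \<in> ?S" using assms by simp
  show "0 \<le> weber_lambda m w a \<Omega> x"
    unfolding weber_lambda_def by (rule cInf_greatest) (use 1 in blast, simp)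
  show "weber_lambda m w a \<Omega> x \<le> 1"
    unfolding weber_lambda_def by (rule cInf_lower[OF 1]) (auto intro: bdd_belowI[of _ 0])
qed

text \<open>
  The angle at the projection \<open>y\<close> between \<open>x\<close> and \<open>T x\<close> is not acute, which makes the linear
  term of the majorant outweigh the quadratic one by a factor of at least two.
\<close>

lemma weber_descent_nonvertex:
  fixes a :: "nat \<Rightarrow> real ^ 'n"
  assumes "x \<notin> vertices m a"
    and A: "weber_A m w a x > 0"
    and w: "\<And>j. j \<in> {1..m} \<Longrightarrow> w j > 0"
    and \<Omega>: "closed \<Omega>" "convex \<Omega>" "x \<in> \<Omega>"
    and "x \<noteq> weber_Q m w a \<Omega> x"
  shows "weber m w a (weber_Q m w a \<Omega> x) < weber m w a x"
proof -
  let ?A = "weber_A m w a x" and ?R = "R_tilde m w a x"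
  define y where "y = weber_Q m w a \<Omega> x"
  have "weber_T m w a x = x + (1 / (2 * ?A)) *\<^sub>R ?R"
    using assms(1) A by (simp add: weber_T_def weber_beta_def weber_gamma_def T_tilde_eq)
  then have "y = closest_point \<Omega> (x + (1 / (2 * ?A)) *\<^sub>R ?R)"
    using assms(1) by (simp add: y_def weber_Q_def)
  then have "inner (x + (1 / (2 * ?A)) *\<^sub>R ?R - y) (x - y) \<le> 0"
    using closest_point_dot[OF \<Omega>(2,1,3)] by simp
  moreover have "inner (x + (1 / (2 * ?A)) *\<^sub>R ?R - y) (x - y)
      = (norm (y - x))\<^sup>2 - (1 / (2 * ?A)) * inner (y - x) ?R"
    unfolding power2_norm_eq_inner by (simp add: inner_diff inner_add inner_commute algebra_simps)
  ultimately have "2 * ?A * (norm (y - x))\<^sup>2 \<le> inner (y - x) ?R"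
    using A by (simp add: field_simps)
  moreover have "{j. j \<in> {1..m} \<and> a j = x} = {}"
    using assms(1) by (auto simp: vertices_def)
  then have "(\<Sum>j | j \<in> {1..m} \<and> a j = x. w j) = 0"
    by (simp only: sum.empty)
  then have "weber m w a y - weber m w a x \<le> ?A * (norm (y - x))\<^sup>2 - inner (y - x) ?R"
    using weber_diff_le[of m w a y x, OF less_imp_le[OF w]] by simp
  moreover have "?A * (norm (y - x))\<^sup>2 > 0"
    using A assms(7) by (simp add: y_def)
  ultimately show ?thesis by (simp add: y_def)
qed

text \<open>
  If the point moves, then \<open>R \<noteq> 0\<close> and \<open>\<beta> < 1\<close>, and it moves in direction \<open>R\<close>. The slope of \<open>f\<close>
  in this direction is \<open>c - \<parallel>R\<parallel> = - (1 - \<beta>) \<parallel>R\<parallel> < 0\<close>, and \<open>T x\<close> minimizes the majorant along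
  this ray, so that every point between \<open>x\<close> and \<open>T x\<close>, and \<open>T x\<close> itself, improves on \<open>x\<close>.
\<close>

lemma weber_descent_vertex:
  fixes a :: "nat \<Rightarrow> real ^ 'n"
  assumes inj: "inj_on a {1..m}"
    and vertex: "x \<in> vertices m a"
    and A: "weber_A m w a x > 0"
    and w: "\<And>j. j \<in> {1..m} \<Longrightarrow> w j > 0"
    and "x \<in> \<Omega>"
    and moves: "x \<noteq> weber_Q m w a \<Omega> x"
  shows "weber m w a (weber_Q m w a \<Omega> x) < weber m w a x"
proof -
  let ?A = "weber_A m w a x" and ?R = "R_tilde m w a x"
  let ?b = "weber_beta m w a x" and ?l = "weber_lambda m w a \<Omega> x"
  define y where "y = weber_Q m w a \<Omega> x"
  define s where "s = (1 - ?l) * (1 - ?b) / (2 * ?A)"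
  obtain k where k: "k \<in> {1..m}" "x = a k"
    using vertex by (auto simp: vertices_def)
  have inv: "inv_into {1..m} a x = k"
    using inj k by (simp add: inv_into_f_f)
  have "weber_T m w a x = x + (1 - ?b) *\<^sub>R (1 / (2 * ?A)) *\<^sub>R ?R"
    using A by (simp add: weber_T_def T_tilde_eq algebra_simps)
  then have "y = (1 - ?l) *\<^sub>R (x + (1 - ?b) *\<^sub>R (1 / (2 * ?A)) *\<^sub>R ?R) + ?l *\<^sub>R x"
    using vertex by (simp add: y_def weber_Q_def)
  also have "\<dots> = x + (1 - ?l) *\<^sub>R (1 - ?b) *\<^sub>R (1 / (2 * ?A)) *\<^sub>R ?R"
    by (simp only: scaleR_add_right) (simp add: scaleR_diff_left)
  also have "\<dots> = x + s *\<^sub>R ?R"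
    by (simp add: s_def)
  finally have y: "y - x = s *\<^sub>R ?R" by simp
  have "s *\<^sub>R ?R \<noteq> 0"
    using y moves by (auto simp: y_def)
  then have s0: "s \<noteq> 0" and R0: "?R \<noteq> 0" by auto
  have l: "0 \<le> ?l" "?l \<le> 1"
    using weber_lambda_bounds[OF \<open>x \<in> \<Omega>\<close>] by blast+
  have b: "?b < 1"
    using s0 by (cases "?b = 1") (auto simp: s_def weber_beta_def)
  \<comment> \<open>Since \<open>\<beta> < 1\<close>, the minimum in its definition is \<open>\<gamma>\<close>; this ties \<open>\<beta>\<close> to the weight at \<open>x\<close>.\<close>
  have "?b = w k / norm ?R"
    using b vertex R0 inv by (auto simp: weber_beta_def weber_gamma_def weber_r_def)
  then have wk: "w k = ?b * norm ?R" using R0 by simp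
  have s: "s > 0"
    using s0 l b A by (simp add: s_def zero_less_mult_iff less_le)
  have "(1 - ?l) * (1 - ?b) \<le> 1 - ?b"
    using l b by (simp add: mult_left_le_one_le)
  then have As: "?A * s \<le> (1 - ?b) / 2"
    using A by (simp add: s_def)
  have "{j. j \<in> {1..m} \<and> a j = x} = {k}"
    using inj k by (auto dest: inj_onD)
  then have "(\<Sum>j | j \<in> {1..m} \<and> a j = x. w j) = w k"
    by (simp only: sum.insert) simp
  then have "weber m w a y - weber m w a x
      \<le> ?A * (norm (s *\<^sub>R ?R))\<^sup>2 - inner (s *\<^sub>R ?R) ?R + w k * norm (s *\<^sub>R ?R)"
    using weber_diff_le[of m w a y x, OF less_imp_le[OF w]] by (simp only: y)
  also have "\<dots> = s * (norm ?R)\<^sup>2 * (?A * s - (1 - ?b))"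
    using s by (simp add: wk power2_norm_eq_inner[symmetric] power2_eq_square algebra_simps)
  also have "\<dots> < 0"
    using s R0 As b by (intro mult_pos_neg) auto
  finally show ?thesis by (simp add: y_def)
qed

theorem theorem17:
  fixes m :: nat and w :: "nat \<Rightarrow> real" and a :: "nat \<Rightarrow> real ^ 'n"
    and \<Omega> :: "(real ^ 'n) set" and x :: "real ^ 'n"
  assumes "inj_on a {1..m}"
    and "\<not> collinear (vertices m a)"
    and "\<And>j. j \<in> {1..m} \<Longrightarrow> w j > 0"
    and "\<Omega> \<noteq> {}" and "closed \<Omega>" and "convex \<Omega>"
    and "x \<in> \<Omega>"
    and "x \<noteq> weber_Q m w a \<Omega> x"
  shows "weber m w a (weber_Q m w a \<Omega> x) < weber m w a x"
proof (cases "x \<in> vertices m a")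
  case True
  then show ?thesis
    using weber_descent_vertex weber_A_pos assms by blast
next
  case False
  then show ?thesis
    using weber_descent_nonvertex weber_A_pos assms by blast
qed

end
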